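(* There exist a non-empty compact metric space $(X,d)$ and continuous functions $f,g:X\to X$ such that $\{f,g\}$ is a contractive family and no word in $f,g$ has a fixed point.
   Context: For a non-empty complete metric space $(X,d)$, continuous functions $f_1,\dots,f_n:X\to X$ and a real number $\lambda\in(0,1)$, the family $\{f_1,\dots,f_n\}$ is called $\lambda$-contractive if for every pair of points $x,y\in X$ there is $i$ with $d(f_i(x),f_i(y))\le\lambda d(x,y)$. The family is contractive if it is $\lambda$-contractive for some $\lambda\in(0,1)$. A word in $f,g$ is a composition $h_1\circ h_2\circ\dots\circ h_m$ with $m\ge 1$ and each $h_i\in\{f,g\}$. *)

theory Defs
  imports "HOL-Analysis.Analysis"
begin

definition lambda_contractive ::
    "'a set \<Rightarrow> ('a \<Rightarrow> 'a \<Rightarrow> real) \<Rightarrow> real \<Rightarrow> ('a \<Rightarrow> 'a) set \<Rightarrow> bool" where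
  "lambda_contractive X d l F \<longleftrightarrow>
     0 < l \<and> l < 1 \<and> (\<forall>x\<in>X. \<forall>y\<in>X. \<exists>h\<in>F. d (h x) (h y) \<le> l * d x y)"

definition contractive :: "'a set \<Rightarrow> ('a \<Rightarrow> 'a \<Rightarrow> real) \<Rightarrow> ('a \<Rightarrow> 'a) set \<Rightarrow> bool" where
  "contractive X d F \<longleftrightarrow> (\<exists>l. lambda_contractive X d l F)"

text \<open>The list \<open>[h1, \<dots>, hm]\<close> stands for the composition \<open>h1 \<circ> \<dots> \<circ> hm\<close>; the empty
  list is excluded, so the identity is a word only if it arises as a non-empty composition.\<close>

definition words_in :: "('a \<Rightarrow> 'a) \<Rightarrow> ('a \<Rightarrow> 'a) \<Rightarrow> ('a \<Rightarrow> 'a) set" where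
  "words_in f g = {foldr (\<circ>) hs id | hs. hs \<noteq> [] \<and> set hs \<subseteq> {f, g}}"

text \<open>HOL cannot quantify existentially over types, so the main statement asks for a metric
  space whose carrier is a set of reals, with an arbitrary metric \<open>d\<close> unrelated to the usual one.
  This is no restriction: a compact metric space is separable, hence has at most continuum many
  points, and can be transported along an injection into the reals.  The maps are total functions
  of which only the restriction to the carrier matters; \<open>continuous_map\<close> includes that they map
  the carrier into itself.\<close>

end

theory Submission
  imports Defs
begin

text \<open>
  The space is the Cantor set, written as the set of all subsets \<open>A\<close> of \<open>\<nat>\<close>, with the distance
  \<open>2\<^sup>-\<^sup>n\<close> where \<open>n\<close> is the first index at which two points differ. The two maps, indexed by the
  letters \<open>True\<close> and \<open>False\<close>, form the inverse limit of finite systems: the system of level \<open>k\<close>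
  acts on the subsets of \<open>{..<k}\<close>, and level \<open>k + 1\<close> acts on one more bit, compatibly with
  forgetting that bit. Such maps are automatically 1-Lipschitz.

  Two points whose first difference is at \<open>k\<close> lie over the same vertex \<open>v\<close> of level \<open>k\<close>. So the
  family is \<open>1/2\<close>-contractive as soon as, over each vertex of each level, at least one letter
  forgets the new bit (\<open>letter_outside_edges\<close>). The other letter may do anything to it, and this
  is the freedom used to destroy fixed points of words.

  At level \<open>k\<close> take a word \<open>w\<close> of minimal length among those that fix some vertex, and a vertex
  \<open>v0\<close> that it fixes. By minimality, \<open>w\<close> leads \<open>v0\<close> around a cycle of distinct vertices, so the
  cycle uses only one letter at each of its vertices. Let every step of this cycle copy the new
  bit, except that the step leaving \<open>v0\<close> flips it; all other steps set the new bit to \<open>0\<close>.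
  The letter that the cycle does not use forgets the bit, as required. Consider another word \<open>u\<close>
  of the same length and a vertex fixed by it. If its path stays on the cycle, it passes \<open>v0\<close>
  exactly once, so the bit is flipped and no fixed point lies above; this
  happens for \<open>w\<close> and \<open>v0\<close>. If its path leaves the cycle, the bit is forgotten and only one fixed
  point lies above. So the number of fixed points of words of that length strictly decreases
  (\<open>card_fixed_pairs_extend\<close>). Hence for each length there is a level beyond which no word of that
  length fixes a vertex (\<open>eventually_no_short_fixed\<close>), and a fixed point of a word in the limit
  would give one at every level.
\<close>

section \<open>Metrics of Cantor type\<close>

text \<open>The metric is pulled back along a bijection \<open>e\<close> onto the subsets of \<open>\<nat>\<close>, so that the Cantor
  set can be carried by any type of size continuum, in particular by the reals.\<close>

definition cantor_dist :: "('a \<Rightarrow> nat set) \<Rightarrow> 'a \<Rightarrow> 'a \<Rightarrow> real" where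
  "cantor_dist e x y =
     (if e x = e y then 0 else (1/2) ^ (LEAST n. (n \<in> e x) \<noteq> (n \<in> e y)))"

lemma cantor_dist_le_iff:
  "cantor_dist e x y \<le> (1/2) ^ n \<longleftrightarrow> e x \<inter> {..<n} = e y \<inter> {..<n}"
proof (cases "e x = e y")
  case True
  then show ?thesis by (simp add: cantor_dist_def)
next
  case False
  define m where "m = (LEAST n. (n \<in> e x) \<noteq> (n \<in> e y))"
  from False have "\<exists>n. (n \<in> e x) \<noteq> (n \<in> e y)" by blast
  then have m: "(m \<in> e x) \<noteq> (m \<in> e y)" unfolding m_def by (rule LeastI_ex)
  have below: "(i \<in> e x) = (i \<in> e y)" if "i < m" for i
    using not_less_Least[of i "\<lambda>n. (n \<in> e x) \<noteq> (n \<in> e y)"] that unfolding m_def by blast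
  have "cantor_dist e x y = (1/2) ^ m"
    using False by (simp add: cantor_dist_def m_def)
  then have "cantor_dist e x y \<le> (1/2) ^ n \<longleftrightarrow> n \<le> m"
    by (simp add: power_decreasing_iff)
  also have "\<dots> \<longleftrightarrow> e x \<inter> {..<n} = e y \<inter> {..<n}"
  proof
    assume "n \<le> m"
    then show "e x \<inter> {..<n} = e y \<inter> {..<n}" using below by auto
  next
    assume "e x \<inter> {..<n} = e y \<inter> {..<n}"
    then show "n \<le> m" using m by (metis IntD1 IntI lessThan_iff not_le)
  qed
  finally show ?thesis .
qed

lemma cantor_dist_eq_power:
  assumes "e x \<noteq> e y"
  obtains n where "cantor_dist e x y = (1/2) ^ n"
  using assms by (simp add: cantor_dist_def)

lemma cantor_dist_nonneg: "0 \<le> cantor_dist e x y"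
  by (simp add: cantor_dist_def)

lemma cantor_dist_commute: "cantor_dist e x y = cantor_dist e y x"
proof -
  have "(\<lambda>n. (n \<in> e x) \<noteq> (n \<in> e y)) = (\<lambda>n. (n \<in> e y) \<noteq> (n \<in> e x))" by auto
  then show ?thesis unfolding cantor_dist_def by auto
qed

lemma cantor_dist_le_if_agree:
  assumes "\<And>n. e x \<inter> {..<n} = e y \<inter> {..<n} \<Longrightarrow> e x' \<inter> {..<n} = e y' \<inter> {..<n}"
  shows "cantor_dist e x' y' \<le> cantor_dist e x y"
proof (cases "e x = e y")
  case True
  then have "e x' \<inter> {..<n} = e y' \<inter> {..<n}" for n using assms by simp
  then have "i \<in> e x' \<longleftrightarrow> i \<in> e y'" for i by (metis Int_iff lessI lessThan_iff)
  then have "e x' = e y'" by blast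
  then show ?thesis by (simp add: cantor_dist_def)
next
  case False
  then obtain n where "cantor_dist e x y = (1/2) ^ n" by (rule cantor_dist_eq_power)
  then show ?thesis using assms cantor_dist_le_iff by (metis order_refl)
qed

lemma Metric_space_cantor_dist:
  assumes "bij e"
  shows "Metric_space UNIV (cantor_dist e)"
proof
  fix x y z
  show "0 \<le> cantor_dist e x y" by (rule cantor_dist_nonneg)
  show "cantor_dist e x y = cantor_dist e y x" by (rule cantor_dist_commute)
  show "cantor_dist e x y = 0 \<longleftrightarrow> x = y"
    using assms by (auto simp: cantor_dist_def bij_def inj_eq)
  have "cantor_dist e x z \<le> max (cantor_dist e x y) (cantor_dist e y z)"
  proof (cases "cantor_dist e x y \<le> cantor_dist e y z")
    case True
    have "cantor_dist e x z \<le> cantor_dist e y z"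
    proof (rule cantor_dist_le_if_agree)
      fix n assume "e y \<inter> {..<n} = e z \<inter> {..<n}"
      moreover from this have "cantor_dist e x y \<le> (1/2) ^ n"
        using True by (simp flip: cantor_dist_le_iff)
      ultimately show "e x \<inter> {..<n} = e z \<inter> {..<n}" by (simp add: cantor_dist_le_iff)
    qed
    then show ?thesis by simp
  next
    case False
    have "cantor_dist e x z \<le> cantor_dist e x y"
    proof (rule cantor_dist_le_if_agree)
      fix n assume "e x \<inter> {..<n} = e y \<inter> {..<n}"
      moreover from this have "cantor_dist e y z \<le> (1/2) ^ n"
        using False by (simp flip: cantor_dist_le_iff)
      ultimately show "e x \<inter> {..<n} = e z \<inter> {..<n}" by (simp add: cantor_dist_le_iff)
    qed
    then show ?thesis by simp
  qed
  then show "cantor_dist e x z \<le> cantor_dist e x y + cantor_dist e y z"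
    using cantor_dist_nonneg[of e x y] cantor_dist_nonneg[of e y z] by linarith
qed

lemma compact_space_cantor_dist:
  fixes e :: "'a \<Rightarrow> nat set"
  assumes "bij e"
  shows "compact_space (Metric_space.mtopology UNIV (cantor_dist e))"
proof -
  interpret Metric_space UNIV "cantor_dist e" by (rule Metric_space_cantor_dist[OF assms])
  have small: "\<exists>n. (1/2) ^ n < \<epsilon>" if "\<epsilon> > 0" for \<epsilon> :: real
    using that by (intro real_arch_pow_inv) auto
  have e_inv: "e (inv e A) = A" for A
    using assms by (simp add: bij_is_surj surj_f_inv_f)
  have mcomplete
    unfolding mcomplete_def
  proof (intro allI impI)
    fix \<sigma> assume \<sigma>: "MCauchy \<sigma>"
    have "\<exists>N. \<forall>i\<ge>N. \<forall>j\<ge>N. e (\<sigma> i) \<inter> {..<n} = e (\<sigma> j) \<inter> {..<n}" for n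
    proof -
      have "(0::real) < (1/2) ^ n" by simp
      then obtain N where N: "\<And>i j. N \<le> i \<Longrightarrow> N \<le> j \<Longrightarrow> cantor_dist e (\<sigma> i) (\<sigma> j) < (1/2) ^ n"
        using \<sigma> unfolding MCauchy_def by meson
      have "e (\<sigma> i) \<inter> {..<n} = e (\<sigma> j) \<inter> {..<n}" if "N \<le> i" "N \<le> j" for i j
        using less_imp_le[OF N[OF that]] by (simp only: cantor_dist_le_iff)
      then show ?thesis by blast
    qed
    then have "\<exists>N. \<forall>n. \<forall>i\<ge>N n. \<forall>j\<ge>N n. e (\<sigma> i) \<inter> {..<n} = e (\<sigma> j) \<inter> {..<n}"
      by (intro choice allI)
    then obtain N where
      N: "\<And>n i j. i \<ge> N n \<Longrightarrow> j \<ge> N n \<Longrightarrow> e (\<sigma> i) \<inter> {..<n} = e (\<sigma> j) \<inter> {..<n}"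
      by blast
    define L where "L = {j. j \<in> e (\<sigma> (N (Suc j)))}"
    have agree: "e (\<sigma> i) \<inter> {..<n} = L \<inter> {..<n}" if i: "\<forall>k\<le>n. i \<ge> N k" for i n
    proof -
      have "j \<in> e (\<sigma> i) \<longleftrightarrow> j \<in> L" if "j < n" for j
      proof -
        have "i \<ge> N (Suc j)" using i that by simp
        then have "e (\<sigma> i) \<inter> {..<Suc j} = e (\<sigma> (N (Suc j))) \<inter> {..<Suc j}" by (rule N) simp
        then have "j \<in> e (\<sigma> i) \<inter> {..<Suc j} \<longleftrightarrow> j \<in> e (\<sigma> (N (Suc j))) \<inter> {..<Suc j}"
          by (rule arg_cong)
        then show ?thesis by (simp add: L_def)
      qed
      then show ?thesis by auto
    qed
    have "\<exists>M. \<forall>i\<ge>M. cantor_dist e (\<sigma> i) (inv e L) < \<epsilon>" if pos: "\<epsilon> > 0" for \<epsilon>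
    proof -
      obtain n where n: "(1/2) ^ n < \<epsilon>" using small[OF pos] by blast
      have "cantor_dist e (\<sigma> i) (inv e L) < \<epsilon>" if "i \<ge> Max (N ` {..n})" for i
      proof -
        have "\<forall>k\<le>n. i \<ge> N k" using that by simp
        then have "cantor_dist e (\<sigma> i) (inv e L) \<le> (1/2) ^ n"
          using agree by (simp add: cantor_dist_le_iff e_inv)
        then show ?thesis using n by simp
      qed
      then show ?thesis by blast
    qed
    then have "limitin mtopology \<sigma> (inv e L) sequentially"
      by (simp add: limit_metric_sequentially)
    then show "\<exists>x. limitin mtopology \<sigma> x sequentially" by blast
  qed
  moreover have "mtotally_bounded UNIV"
    unfolding mtotally_bounded_def
  proof (intro allI impI)
    fix \<epsilon> :: real assume "\<epsilon> > 0"
    then obtain n where n: "(1/2) ^ n < \<epsilon>" using small by blast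
    have "x \<in> mball (inv e (e x \<inter> {..<n})) \<epsilon>" for x
    proof -
      have "cantor_dist e (inv e (e x \<inter> {..<n})) x \<le> (1/2) ^ n"
        by (simp add: cantor_dist_le_iff e_inv)
      then show ?thesis using n by simp
    qed
    moreover have "inv e (e x \<inter> {..<n}) \<in> inv e ` Pow {..<n}" for x by simp
    ultimately have "UNIV \<subseteq> (\<Union>x \<in> inv e ` Pow {..<n}. mball x \<epsilon>)"
      by (intro subsetI UN_I)
    moreover have "finite (inv e ` Pow {..<n})" by simp
    ultimately show "\<exists>K. finite K \<and> K \<subseteq> UNIV \<and> UNIV \<subseteq> (\<Union>x\<in>K. mball x \<epsilon>)"
      using subset_UNIV by metis
  qed
  ultimately show ?thesis by (simp add: compact_space_eq_mcomplete_mtotally_bounded)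
qed

section \<open>Paths and shortest cycles of two-letter systems\<close>

text \<open>A system is a family of two maps \<open>H True\<close> and \<open>H False\<close>; a word \<open>u\<close> acts by \<open>fold H u\<close>, its
  first letter being applied first.\<close>

primrec path :: "(bool \<Rightarrow> 'a \<Rightarrow> 'a) \<Rightarrow> bool list \<Rightarrow> 'a \<Rightarrow> 'a list" where
  "path H [] v = []"
| "path H (b # u) v = v # path H u (H b v)"

definition path_edges :: "(bool \<Rightarrow> 'a \<Rightarrow> 'a) \<Rightarrow> bool list \<Rightarrow> 'a \<Rightarrow> (bool \<times> 'a) set" where
  "path_edges H u v = set (zip u (path H u v))"

definition shortest_cycle :: "(bool \<Rightarrow> 'a \<Rightarrow> 'a) \<Rightarrow> bool list \<times> 'a \<Rightarrow> bool" where
  "shortest_cycle H c \<longleftrightarrow> fst c \<noteq> [] \<and> fold H (fst c) (snd c) = snd c \<and>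
     (\<forall>u v. u \<noteq> [] \<and> fold H u v = v \<longrightarrow> length (fst c) \<le> length u)"

lemma length_path [simp]: "length (path H u v) = length u"
  by (induction u arbitrary: v) auto

lemma path_edges_Nil [simp]: "path_edges H [] v = {}"
  by (simp add: path_edges_def)

lemma path_edges_Cons [simp]:
  "path_edges H (b # u) v = insert (b, v) (path_edges H u (H b v))"
  by (simp add: path_edges_def)

lemma nth_path: "i < length u \<Longrightarrow> path H u v ! i = fold H (take i u) v"
proof (induction u arbitrary: v i)
  case (Cons b u)
  then show ?case by (cases i) auto
qed simp

lemma set_path: "set (path H u v) = snd ` path_edges H u v"
  by (metis length_path map_snd_zip path_edges_def set_map)

text \<open>A repeated vertex would cut out a strictly shorter word with a fixed point.\<close>

lemma distinct_path:
  assumes "\<And>u' v'. u' \<noteq> [] \<Longrightarrow> fold H u' v' = v' \<Longrightarrow> length u \<le> length u'"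
  shows "distinct (path H u v)"
proof (rule ccontr)
  assume "\<not> distinct (path H u v)"
  then obtain i j where ij: "i < j" "j < length u" "path H u v ! i = path H u v ! j"
    unfolding distinct_conv_nth by (metis length_path linorder_neqE_nat)
  define u' where "u' = take (j - i) (drop i u)"
  have "take j u = take i u @ u'"
    using ij unfolding u'_def by (metis le_add_diff_inverse less_imp_le take_add)
  then have "fold H u' (path H u v ! i) = path H u v ! i"
    using ij by (simp add: nth_path)
  moreover have len: "length u' = j - i" using ij by (simp add: u'_def)
  moreover from len have "u' \<noteq> []" using ij by auto
  ultimately have "length u \<le> j - i" using assms by metis
  then show False using ij by simp
qed

lemma shortest_cycle_distinct:
  assumes "shortest_cycle H c"
  shows "distinct (path H (fst c) (snd c))"
  using assms by (intro distinct_path) (auto simp: shortest_cycle_def)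

lemma count_list_distinct: "distinct xs \<Longrightarrow> count_list xs x = (if x \<in> set xs then 1 else 0)"
  by (induction xs) auto

lemma letter_outside_edges:
  assumes "distinct (path H w v0)"
  obtains b where "(b, v) \<notin> path_edges H w v0"
proof -
  have False if "(True, v) \<in> path_edges H w v0" "(False, v) \<in> path_edges H w v0"
    using that assms unfolding path_edges_def in_set_zip
    by (auto simp: nth_eq_iff_index_eq)
  then show thesis using that by blast
qed

section \<open>Adding one bit to a finite system\<close>

text \<open>Systems on the finite set \<open>Pow {..<k}\<close> are encoded as maps on all subsets of \<open>\<nat>\<close> that see only
  the part of their argument below \<open>k\<close>, so that all levels have the same type.\<close>

definition level :: "nat \<Rightarrow> (bool \<Rightarrow> nat set \<Rightarrow> nat set) \<Rightarrow> bool" where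
  "level k H \<longleftrightarrow> (\<forall>b A. H b (A \<inter> {..<k}) = H b A \<and> H b A \<subseteq> {..<k})"

text \<open>The membership of \<open>k\<close> is the new bit. The steps of the cycle \<open>c\<close> copy it or, at the starting
  vertex \<open>snd c\<close>, flip it; every other step clears it.\<close>

definition extend ::
    "nat \<Rightarrow> (bool \<Rightarrow> nat set \<Rightarrow> nat set) \<Rightarrow> bool list \<times> nat set \<Rightarrow> bool \<Rightarrow> nat set \<Rightarrow> nat set" where
  "extend k H c b A = H b A \<union>
     (if (b, A \<inter> {..<k}) \<in> path_edges H (fst c) (snd c) \<and> ((k \<in> A) \<noteq> (A \<inter> {..<k} = snd c))
      then {k} else {})"

lemma level_subset: "level k H \<Longrightarrow> H b A \<subseteq> {..<k}"
  by (simp add: level_def)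

lemma level_restrict: "level k H \<Longrightarrow> H b (A \<inter> {..<k}) = H b A"
  by (simp add: level_def)

lemma level_extend:
  assumes "level k H"
  shows "level (Suc k) (extend k H c)"
  unfolding level_def
proof (intro allI conjI)
  fix b A
  have "A \<inter> {..<Suc k} \<inter> {..<k} = A \<inter> {..<k}" by auto
  moreover from this have "H b (A \<inter> {..<Suc k}) = H b A"
    using level_restrict[OF assms] by metis
  ultimately show "extend k H c b (A \<inter> {..<Suc k}) = extend k H c b A"
    by (simp add: extend_def)
  show "extend k H c b A \<subseteq> {..<Suc k}"
    using level_subset[OF assms, of b A] by (auto simp: extend_def)
qed

lemma extend_restrict:
  assumes "level k H"
  shows "extend k H c b A \<inter> {..<k} = H b A"
  using level_subset[OF assms, of b A] by (auto simp: extend_def)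

lemma fold_extend_restrict:
  assumes "level k H"
  shows "fold (extend k H c) u A \<inter> {..<k} = fold H u (A \<inter> {..<k})"
  by (induction u arbitrary: A)
     (simp_all add: extend_restrict[OF assms] level_restrict[OF assms])

lemma fixed_restrict:
  assumes "level k H" "fold (extend k H c) u A = A"
  shows "fold H u (A \<inter> {..<k}) = A \<inter> {..<k}"
  using fold_extend_restrict[OF assms(1), of c u A] assms(2) by simp

lemma extend_forgets_outside:
  assumes "level k H" "(b, A \<inter> {..<k}) \<notin> path_edges H (fst c) (snd c)"
      "A \<inter> {..<k} = B \<inter> {..<k}"
  shows "extend k H c b A = extend k H c b B"
  using assms(2,3) level_restrict[OF assms(1), of b A] level_restrict[OF assms(1), of b B]
  by (simp add: extend_def)

lemma fold_extend_forgets_outside: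
  assumes H: "level k H"
    and "\<not> path_edges H u (A \<inter> {..<k}) \<subseteq> path_edges H (fst c) (snd c)"
    and "A \<inter> {..<k} = B \<inter> {..<k}"
  shows "fold (extend k H c) u A = fold (extend k H c) u B"
  using assms(2,3)
proof (induction u arbitrary: A B)
  case (Cons b u)
  show ?case
  proof (cases "(b, A \<inter> {..<k}) \<in> path_edges H (fst c) (snd c)")
    case True
    have r: "extend k H c b A \<inter> {..<k} = H b (A \<inter> {..<k})"
      by (simp add: extend_restrict[OF H] level_restrict[OF H])
    moreover have "extend k H c b B \<inter> {..<k} = H b (A \<inter> {..<k})"
      using Cons.prems(2) by (simp add: extend_restrict[OF H] level_restrict[OF H])
    moreover have "\<not> path_edges H u (H b (A \<inter> {..<k})) \<subseteq> path_edges H (fst c) (snd c)"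
      using True Cons.prems(1) by simp
    ultimately show ?thesis
      using Cons.IH[of "extend k H c b A" "extend k H c b B"] by simp
  next
    case False
    then show ?thesis using extend_forgets_outside[OF H False Cons.prems(2)] by simp
  qed
qed simp

lemma fold_extend_parity_inside:
  assumes H: "level k H"
    and "path_edges H u (A \<inter> {..<k}) \<subseteq> path_edges H (fst c) (snd c)"
  shows "k \<in> fold (extend k H c) u A \<longleftrightarrow>
           (k \<in> A) \<noteq> odd (count_list (path H u (A \<inter> {..<k})) (snd c))"
  using assms(2)
proof (induction u arbitrary: A)
  case (Cons b u)
  have r: "extend k H c b A \<inter> {..<k} = H b (A \<inter> {..<k})"
    by (simp add: extend_restrict[OF H] level_restrict[OF H])
  have "k \<notin> H b A" using level_subset[OF H] by blast
  then have "k \<in> extend k H c b A \<longleftrightarrow> (k \<in> A) \<noteq> (A \<inter> {..<k} = snd c)"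
    using Cons.prems by (simp add: extend_def)
  moreover have "k \<in> fold (extend k H c) u (extend k H c b A) \<longleftrightarrow>
      (k \<in> extend k H c b A) \<noteq> odd (count_list (path H u (H b (A \<inter> {..<k}))) (snd c))"
    using Cons.IH[of "extend k H c b A"] Cons.prems r by simp
  ultimately show ?case by auto
qed simp

text \<open>The path of \<open>u\<close> consists of as many distinct vertices as the cycle has. So if it stays on the
  cycle it visits all of it, and in particular meets the flip exactly once.\<close>

lemma fixed_leaves_cycle:
  assumes H: "level k H" and c: "shortest_cycle H c"
    and u: "length u = length (fst c)" and fixed: "fold (extend k H c) u A = A"
  shows "\<not> path_edges H u (A \<inter> {..<k}) \<subseteq> path_edges H (fst c) (snd c)"
proof
  assume inside: "path_edges H u (A \<inter> {..<k}) \<subseteq> path_edges H (fst c) (snd c)"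
  define p where "p = path H u (A \<inter> {..<k})"
  define q where "q = path H (fst c) (snd c)"
  have dp: "distinct p"
    unfolding p_def using c u by (intro distinct_path) (auto simp: shortest_cycle_def)
  have dq: "distinct q" unfolding q_def by (rule shortest_cycle_distinct[OF c])
  have "set p \<subseteq> set q" unfolding p_def q_def set_path using inside by blast
  moreover have "card (set p) = card (set q)"
    using dp dq u by (simp add: distinct_card p_def q_def)
  ultimately have "set p = set q" by (intro card_subset_eq) auto
  moreover have "snd c \<in> set q"
    using c unfolding q_def shortest_cycle_def by (cases "fst c") auto
  ultimately have "count_list p (snd c) = 1"
    using dp by (simp add: count_list_distinct)
  then show False
    using fold_extend_parity_inside[OF H inside] fixed unfolding p_def by simp
qed

section \<open>Counting fixed points of words\<close>

definition fixed_pairs :: "(bool \<Rightarrow> 'a \<Rightarrow> 'a) \<Rightarrow> nat \<Rightarrow> (bool list \<times> 'a) set" where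
  "fixed_pairs H m = {(u, v). length u = m \<and> fold H u v = v}"

lemma fold_level_subset:
  assumes "level k H" "u \<noteq> []"
  shows "fold H u A \<subseteq> {..<k}"
  using assms level_subset[OF assms(1)] by (cases u rule: rev_cases) auto

lemma finite_fixed_pairs:
  assumes "level k H" "m > 0"
  shows "finite (fixed_pairs H m)"
proof (rule finite_subset)
  show "fixed_pairs H m \<subseteq> {u. set u \<subseteq> UNIV \<and> length u = m} \<times> Pow {..<k}"
  proof (rule subrelI)
    fix u v assume "(u, v) \<in> fixed_pairs H m"
    then have "length u = m" "fold H u v = v" by (simp_all add: fixed_pairs_def)
    moreover from this have "u \<noteq> []" using assms(2) by auto
    ultimately show "(u, v) \<in> {u. set u \<subseteq> UNIV \<and> length u = m} \<times> Pow {..<k}"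
      using fold_level_subset[OF assms(1), of u v] by simp
  qed
  show "finite ({u. set u \<subseteq> (UNIV :: bool set) \<and> length u = m} \<times> Pow {..<k})"
    by (intro finite_cartesian_product finite_lists_length_eq) auto
qed

text \<open>Restriction maps the fixed points of the extended system injectively to those of the given one,
  since no fixed path stays on the cycle; the cycle itself is missed.\<close>

lemma card_fixed_pairs_extend:
  assumes H: "level k H" and c: "shortest_cycle H c"
  shows "card (fixed_pairs (extend k H c) (length (fst c))) < card (fixed_pairs H (length (fst c)))"
proof -
  let ?m = "length (fst c)" and ?r = "\<lambda>(u :: bool list, A). (u, A \<inter> {..<k})"
  let ?P = "fixed_pairs H ?m" and ?P' = "fixed_pairs (extend k H c) ?m"
  have m: "?m > 0" using c by (simp add: shortest_cycle_def)
  have leaves: "\<not> path_edges H u (A \<inter> {..<k}) \<subseteq> path_edges H (fst c) (snd c)"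
    if "(u, A) \<in> ?P'" for u A
    using that fixed_leaves_cycle[OF H c] by (auto simp: fixed_pairs_def)
  have "inj_on ?r ?P'"
  proof (rule inj_onI)
    fix p q assume pq: "p \<in> ?P'" "q \<in> ?P'" "?r p = ?r q"
    obtain u A B where uAB: "p = (u, A)" "q = (u, B)" "A \<inter> {..<k} = B \<inter> {..<k}"
      using pq(3) by (cases p, cases q) simp
    then have "fold (extend k H c) u A = fold (extend k H c) u B"
      using fold_extend_forgets_outside[OF H leaves] pq(1) by blast
    then show "p = q" using pq uAB by (simp add: fixed_pairs_def)
  qed
  moreover have "?r ` ?P' \<subset> ?P"
  proof
    show "?r ` ?P' \<subseteq> ?P"
      by (simp add: fixed_pairs_def image_subset_iff fixed_restrict[OF H, of c] split_beta)
    have "c \<in> ?P" using c by (simp add: fixed_pairs_def shortest_cycle_def split_beta)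
    moreover have "c \<notin> ?r ` ?P'"
    proof
      assume "c \<in> ?r ` ?P'"
      then obtain u A where "(u, A) \<in> ?P'" "c = (u, A \<inter> {..<k})" by auto
      then show False using leaves[of u A] by simp
    qed
    ultimately show "?r ` ?P' \<noteq> ?P" by blast
  qed
  ultimately show ?thesis
    using psubset_card_mono[OF finite_fixed_pairs[OF H m], of "?r ` ?P'"]
    by (simp only: card_image)
qed

text \<open>A word \<open>True\<^sup>n\<close> has a fixed point for some \<open>n > 0\<close> because \<open>Pow {..<k}\<close> is finite.\<close>

lemma shortest_cycle_exists:
  assumes "level k H"
  shows "\<exists>c. shortest_cycle H c"
proof -
  define orbit where "orbit n = fold H (replicate n True) {}" for n
  have "orbit n \<in> Pow {..<k}" for n
    using fold_level_subset[OF assms, of "replicate n True" "{}"]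
    unfolding orbit_def by (cases n) auto
  then have "finite (range orbit)"
    by (meson finite_Pow_iff finite_lessThan finite_subset image_subsetI)
  then have "\<not> inj orbit" using finite_imageD by blast
  then obtain i j where ij: "i < j" "orbit i = orbit j"
    unfolding inj_def by (metis linorder_neqE_nat)
  define u where "u = replicate (j - i) True"
  have "replicate j True = replicate i True @ u"
    using ij unfolding u_def by (metis le_add_diff_inverse less_imp_le replicate_add)
  then have "fold H u (orbit i) = orbit j" unfolding orbit_def by simp
  then have "u \<noteq> [] \<and> (\<exists>v. fold H u v = v)" using ij by (auto simp: u_def)
  then obtain w where w: "w \<noteq> [] \<and> (\<exists>v. fold H w v = v)"
      "\<And>u. u \<noteq> [] \<and> (\<exists>v. fold H u v = v) \<Longrightarrow> length w \<le> length u"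
    using ex_has_least_nat[of "\<lambda>u. u \<noteq> [] \<and> (\<exists>v. fold H u v = v)" u length] by blast
  then obtain v where "fold H w v = v" by blast
  then have "shortest_cycle H (w, v)" using w unfolding shortest_cycle_def by auto
  then show ?thesis by blast
qed

section \<open>The tower of finite systems and its limit\<close>

primrec stage :: "nat \<Rightarrow> bool \<Rightarrow> nat set \<Rightarrow> nat set" where
  "stage 0 = (\<lambda>b A. {})"
| "stage (Suc k) = extend k (stage k) (SOME c. shortest_cycle (stage k) c)"

definition limit_map :: "bool \<Rightarrow> nat set \<Rightarrow> nat set" where
  "limit_map b A = (\<Union>k. stage k b A)"

lemma level_stage: "level k (stage k)"
  by (induction k) (simp_all add: level_extend, simp add: level_def)

lemma stage_Suc:
  obtains c where "shortest_cycle (stage k) c" "stage (Suc k) = extend k (stage k) c"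
  using someI_ex[OF shortest_cycle_exists[OF level_stage[of k]]] by simp

lemma fixed_stage_Suc:
  "fold (stage (Suc k)) u A = A \<Longrightarrow> fold (stage k) u (A \<inter> {..<k}) = A \<inter> {..<k}"
  using fixed_restrict[OF level_stage] by simp

text \<open>Once the words of length at most \<open>m\<close> have no fixed points, the shortest cycles have length at
  least \<open>m + 1\<close>, and while the length is \<open>m + 1\<close>, each stage lowers the number of fixed points of
  words of that length.\<close>

lemma eventually_no_short_fixed:
  "\<exists>K. \<forall>k\<ge>K. \<forall>u A. u \<noteq> [] \<and> length u \<le> m \<longrightarrow> fold (stage k) u A \<noteq> A"
proof (induction m)
  case 0
  then show ?case by simp
next
  case (Suc m)
  then obtain K where
    K: "\<And>k u A. k \<ge> K \<Longrightarrow> u \<noteq> [] \<Longrightarrow> length u \<le> m \<Longrightarrow> fold (stage k) u A \<noteq> A" by blast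
  have fin: "finite (fixed_pairs (stage k) (Suc m))" for k
    by (rule finite_fixed_pairs[OF level_stage]) simp
  have step: "card (fixed_pairs (stage (Suc k)) (Suc m)) < card (fixed_pairs (stage k) (Suc m))"
    if k: "k \<ge> K" and ne: "fixed_pairs (stage k) (Suc m) \<noteq> {}" for k
  proof -
    obtain c where c: "shortest_cycle (stage k) c" "stage (Suc k) = extend k (stage k) c"
      by (rule stage_Suc)
    obtain u v where "length u = Suc m" "fold (stage k) u v = v"
      using ne unfolding fixed_pairs_def by blast
    moreover from this have "u \<noteq> []" by auto
    ultimately have "length (fst c) \<le> Suc m" using c(1) unfolding shortest_cycle_def by metis
    moreover have "\<not> length (fst c) \<le> m"
      using K[OF k, of "fst c" "snd c"] c(1) unfolding shortest_cycle_def by blast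
    ultimately have "length (fst c) = Suc m" by simp
    then show ?thesis using card_fixed_pairs_extend[OF level_stage c(1)] c(2) by simp
  qed
  have "\<exists>k\<ge>K. fixed_pairs (stage k) (Suc m) = {}"
  proof (rule ccontr)
    assume nonempty: "\<not> (\<exists>k\<ge>K. fixed_pairs (stage k) (Suc m) = {})"
    have "card (fixed_pairs (stage (K + n)) (Suc m)) + n \<le> card (fixed_pairs (stage K) (Suc m))"
      for n
    proof (induction n)
      case (Suc n)
      have "card (fixed_pairs (stage (Suc (K + n))) (Suc m))
              < card (fixed_pairs (stage (K + n)) (Suc m))"
        using nonempty by (intro step) auto
      then show ?case using Suc.IH by (simp only: add_Suc_right)
    qed simp
    from this[of "Suc (card (fixed_pairs (stage K) (Suc m)))"] show False by simp
  qed
  then obtain K' where K': "K' \<ge> K" "fixed_pairs (stage K') (Suc m) = {}" by blast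
  have "fixed_pairs (stage k) (Suc m) = {}" if "k \<ge> K'" for k
    using that
  proof (induction k rule: dec_induct)
    case (step k)
    have "(u, A) \<notin> fixed_pairs (stage (Suc k)) (Suc m)" for u A
    proof
      assume "(u, A) \<in> fixed_pairs (stage (Suc k)) (Suc m)"
      then have "(u, A \<inter> {..<k}) \<in> fixed_pairs (stage k) (Suc m)"
        using fixed_stage_Suc[of k u A] unfolding fixed_pairs_def by blast
      then show False using step.IH by blast
    qed
    then show ?case by auto
  qed (rule K'(2))
  then have long: "fold (stage k) u A \<noteq> A" if "k \<ge> K'" "length u = Suc m" for k u A
    using that unfolding fixed_pairs_def by blast
  have "fold (stage k) u A \<noteq> A" if "k \<ge> K'" "u \<noteq> []" "length u \<le> Suc m" for k u A
  proof (cases "length u = Suc m")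
    case True
    then show ?thesis by (rule long[OF that(1)])
  next
    case False
    then have "length u \<le> m" using that(3) by simp
    then show ?thesis using that(1) K'(1) by (intro K that(2)) simp_all
  qed
  then show ?case by blast
qed

lemma stage_restrict:
  assumes "k \<le> j"
  shows "stage j b A \<inter> {..<k} = stage k b A"
  using assms
proof (induction j rule: dec_induct)
  case base
  then show ?case using level_subset[OF level_stage] by blast
next
  case (step j)
  have "stage (Suc j) b A \<inter> {..<j} = stage j b A"
    by (simp add: extend_restrict[OF level_stage])
  moreover have "{..<k} = {..<j} \<inter> {..<k}" using step.hyps by auto
  ultimately show ?case using step.IH by (metis Int_assoc)
qed

lemma limit_map_restrict: "limit_map b A \<inter> {..<k} = stage k b A"
proof
  show "limit_map b A \<inter> {..<k} \<subseteq> stage k b A"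
  proof
    fix x assume "x \<in> limit_map b A \<inter> {..<k}"
    then obtain j where j: "x \<in> stage j b A" "x < k" by (auto simp: limit_map_def)
    show "x \<in> stage k b A"
    proof (cases "k \<le> j")
      case True
      then show ?thesis using j stage_restrict[OF True, of b A] by blast
    next
      case False
      then show ?thesis using j stage_restrict[of j k b A] by auto
    qed
  qed
  show "stage k b A \<subseteq> limit_map b A \<inter> {..<k}"
    using level_subset[OF level_stage] by (auto simp: limit_map_def)
qed

lemma fold_limit_map_restrict:
  "fold limit_map u A \<inter> {..<k} = fold (stage k) u (A \<inter> {..<k})"
  by (induction u arbitrary: A) (simp_all add: limit_map_restrict level_restrict[OF level_stage])

lemma limit_map_no_fixed:
  assumes "u \<noteq> []"
  shows "fold limit_map u A \<noteq> A"
proof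
  assume "fold limit_map u A = A"
  then have "fold (stage k) u (A \<inter> {..<k}) = A \<inter> {..<k}" for k
    using fold_limit_map_restrict[of u A k] by simp
  then show False using eventually_no_short_fixed[of "length u"] assms by blast
qed

lemma limit_map_agree:
  assumes "A \<inter> {..<n} = B \<inter> {..<n}"
  shows "limit_map b A \<inter> {..<n} = limit_map b B \<inter> {..<n}"
  using assms level_restrict[OF level_stage, of n b A] level_restrict[OF level_stage, of n b B]
  by (simp add: limit_map_restrict)

text \<open>If \<open>A\<close> and \<open>B\<close> lie over the same vertex of level \<open>n\<close>, a letter that the cycle chosen at that
  level does not use there forgets the bit \<open>n\<close>.\<close>

lemma limit_map_gains_bit:
  assumes "A \<inter> {..<n} = B \<inter> {..<n}"
  obtains b where "limit_map b A \<inter> {..<Suc n} = limit_map b B \<inter> {..<Suc n}"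
proof -
  obtain c where c: "shortest_cycle (stage n) c" "stage (Suc n) = extend n (stage n) c"
    by (rule stage_Suc)
  obtain b where "(b, A \<inter> {..<n}) \<notin> path_edges (stage n) (fst c) (snd c)"
    by (rule letter_outside_edges[OF shortest_cycle_distinct[OF c(1)]])
  then have "stage (Suc n) b A = stage (Suc n) b B"
    using extend_forgets_outside[OF level_stage _ assms] c(2) by simp
  then show thesis using that limit_map_restrict by metis
qed

section \<open>The contractive family\<close>

lemma conjugate_foldr:
  assumes "bij e"
  shows "e (foldr (\<circ>) (map (\<lambda>b. inv e \<circ> H b \<circ> e) bs) id x) = fold H (rev bs) (e x)"
  using assms by (induction bs) (simp_all add: bij_is_surj surj_f_inv_f)

theorem theorem1p3:
  "\<exists>(X :: real set) (d :: real \<Rightarrow> real \<Rightarrow> real) (f :: real \<Rightarrow> real) (g :: real \<Rightarrow> real).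
     Metric_space X d \<and> X \<noteq> {} \<and>
     compact_space (Metric_space.mtopology X d) \<and>
     continuous_map (Metric_space.mtopology X d) (Metric_space.mtopology X d) f \<and>
     continuous_map (Metric_space.mtopology X d) (Metric_space.mtopology X d) g \<and>
     contractive X d {f, g} \<and>
     (\<forall>w\<in>words_in f g. \<not> (\<exists>x\<in>X. w x = x))"
proof -
  obtain e :: "real \<Rightarrow> nat set" where e: "bij e"
    using eqpoll_sym[OF nat_sets_eqpoll_reals] unfolding eqpoll_def by blast
  have e_inv: "e (inv e A) = A" for A
    using e by (simp add: bij_is_surj surj_f_inv_f)
  define d where "d = cantor_dist e"
  define h where "h = (\<lambda>b. inv e \<circ> limit_map b \<circ> e)"
  have e_h: "e (h b x) = limit_map b (e x)" for b x
    by (simp add: h_def e_inv)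
  interpret Metric_space UNIV d
    unfolding d_def by (rule Metric_space_cantor_dist[OF e])
  have nonexpanding: "d (h b x) (h b y) \<le> d x y" for b x y
    unfolding d_def by (rule cantor_dist_le_if_agree) (unfold e_h, rule limit_map_agree)
  have continuous: "continuous_map mtopology mtopology (h b)" for b
    unfolding metric_continuous_map[OF Metric_space_axioms]
  proof (intro conjI ballI allI impI)
    fix x and \<epsilon> :: real assume "\<epsilon> > 0"
    then show "\<exists>\<delta>>0. \<forall>y. y \<in> UNIV \<and> d x y < \<delta> \<longrightarrow> d (h b x) (h b y) < \<epsilon>"
      using le_less_trans[OF nonexpanding] by blast
  qed simp
  have contracts: "\<exists>b. d (h b x) (h b y) \<le> 1/2 * d x y" for x y
  proof (cases "e x = e y")
    case True
    then show ?thesis by (simp add: d_def cantor_dist_def e_h)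
  next
    case False
    then obtain n where n: "cantor_dist e x y = (1/2) ^ n" by (rule cantor_dist_eq_power)
    then have "e x \<inter> {..<n} = e y \<inter> {..<n}" using cantor_dist_le_iff[of e x y n] by simp
    then obtain b where "limit_map b (e x) \<inter> {..<Suc n} = limit_map b (e y) \<inter> {..<Suc n}"
      by (rule limit_map_gains_bit)
    then have "d (h b x) (h b y) \<le> (1/2) ^ Suc n"
      unfolding d_def by (simp only: cantor_dist_le_iff e_h)
    then show ?thesis using n by (auto simp: d_def)
  qed
  have "\<exists>f\<in>{h True, h False}. d (f x) (f y) \<le> 1/2 * d x y" for x y
  proof -
    obtain b where "d (h b x) (h b y) \<le> 1/2 * d x y" using contracts by blast
    moreover have "h b \<in> {h True, h False}" by (cases b) simp_all
    ultimately show ?thesis by blast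
  qed
  then have "lambda_contractive UNIV d (1/2) {h True, h False}"
    unfolding lambda_contractive_def by simp
  then have "contractive UNIV d {h True, h False}"
    unfolding contractive_def by blast
  moreover have "w x \<noteq> x" if w: "w \<in> words_in (h True) (h False)" for w x
  proof
    assume fixed: "w x = x"
    obtain hs where hs: "w = foldr (\<circ>) hs id" "hs \<noteq> []" "set hs \<subseteq> {h True, h False}"
      using w unfolding words_in_def by blast
    then have "set hs \<subseteq> range h" by blast
    then obtain bs where bs: "hs = map h bs" using ex_map_conv[of hs h] by blast
    have "fold limit_map (rev bs) (e x) = e x"
      using conjugate_foldr[OF e, of limit_map bs x] fixed hs(1) bs by (simp add: h_def)
    then show False using limit_map_no_fixed[of "rev bs"] hs(2) bs by simp
  qed
  moreover have "compact_space mtopology"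
    unfolding d_def by (rule compact_space_cantor_dist[OF e])
  ultimately show ?thesis
    using Metric_space_axioms continuous
    by (intro exI[of _ UNIV] exI[of _ d] exI[of _ "h True"] exI[of _ "h False"]) blast
qed

end
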